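(* For every odd integer $n\ge3$, the oriented cycle $\vec{C}_n$ of order $n$ has average uniform mixing, that is, $\widehat{M}_{\vec{C}_n}=\frac1nJ_n$.
   Context: The oriented cycle $\vec{C}_n$ has vertex set $\mathbb{Z}/n\mathbb{Z}$ and Hermitian adjacency matrix $A$ with $A_{j,j+1}=-i$ and $A_{j+1,j}=i$ for all $j\in\mathbb{Z}/n\mathbb{Z}$, and all other entries $0$ (edges consistently directed around the cycle). For a graph $X$ of order $n$ with Hermitian adjacency matrix $A$, let $U_X(t)=e^{-itA}$ and $M_X(t)=U_X(t)\circ\overline{U_X(t)}$ (entrywise product). The average mixing matrix is $\widehat{M}_X=\lim_{T\to\infty}\frac1T\int_0^TM_X(t)\,dt$. $X$ has average uniform mixing if $\widehat{M}_X=\frac1nJ_n$, where $J_n$ is the all-one matrix. *)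

theory Defs
  imports
    "HOL-Analysis.Analysis"
    "Jordan_Normal_Form.Matrix"
begin

text \<open>
  The matrices are those of \<^theory>\<open>Jordan_Normal_Form.Matrix\<close>. They carry no topology, so
  series, integrals and limits of square matrices are taken entrywise.
\<close>

definition mat_exp :: "complex Matrix.mat \<Rightarrow> complex Matrix.mat" where
  "mat_exp A = Matrix.mat (dim_row A) (dim_row A)
     (\<lambda>(j, k). \<Sum>m. (A ^\<^sub>m m) $$ (j, k) / fact m)"

definition hadamard_prod :: "complex Matrix.mat \<Rightarrow> complex Matrix.mat \<Rightarrow> complex Matrix.mat" where
  "hadamard_prod A B = Matrix.mat (dim_row A) (dim_col A) (\<lambda>(j, k). A $$ (j, k) * B $$ (j, k))"

definition all_ones_mat :: "nat \<Rightarrow> complex Matrix.mat" where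
  "all_ones_mat n = Matrix.mat n n (\<lambda>_. 1)"

text \<open>
  In the following definitions a graph of order \<open>n\<close> is given by its Hermitian adjacency matrix,
  an \<open>n \<times> n\<close> matrix \<open>A\<close> with rows and columns indexed by \<open>0, \<dots>, n - 1\<close>.
\<close>

definition transition_matrix :: "complex Matrix.mat \<Rightarrow> real \<Rightarrow> complex Matrix.mat" where
  "transition_matrix A t = mat_exp ((- \<i> * of_real t) \<cdot>\<^sub>m A)"

definition mixing_matrix :: "complex Matrix.mat \<Rightarrow> real \<Rightarrow> complex Matrix.mat" where
  "mixing_matrix A t =
     hadamard_prod (transition_matrix A t) (map_mat cnj (transition_matrix A t))"

definition time_average :: "complex Matrix.mat \<Rightarrow> nat \<Rightarrow> nat \<Rightarrow> real \<Rightarrow> complex" where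
  "time_average A j k T = 1 / of_real T * integral {0..T} (\<lambda>t. mixing_matrix A t $$ (j, k))"

definition average_mixing_matrix :: "complex Matrix.mat \<Rightarrow> complex Matrix.mat" where
  "average_mixing_matrix A =
     Matrix.mat (dim_row A) (dim_row A) (\<lambda>(j, k). Lim at_top (time_average A j k))"

text \<open>
  \<^const>\<open>Lim\<close> is unspecified where no limit exists, so existence of the limits is demanded explicitly.
\<close>

definition average_uniform_mixing :: "complex Matrix.mat \<Rightarrow> bool" where
  "average_uniform_mixing A \<longleftrightarrow>
     (\<forall>j < dim_row A. \<forall>k < dim_row A. \<exists>l. (time_average A j k \<longlongrightarrow> l) at_top) \<and>
     average_mixing_matrix A = (1 / of_nat (dim_row A)) \<cdot>\<^sub>m all_ones_mat (dim_row A)"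

text \<open>
  The vertices in \<open>\<int>/n\<int>\<close> are represented by \<open>0, \<dots>, n - 1\<close>. The first two cases exclude each
  other when \<open>n \<ge> 3\<close>; for smaller \<open>n\<close> the matrix is not meaningful.
\<close>

definition oriented_cycle :: "nat \<Rightarrow> complex Matrix.mat" where
  "oriented_cycle n = Matrix.mat n n (\<lambda>(j, k).
     if k = (j + 1) mod n then - \<i>
     else if j = (k + 1) mod n then \<i>
     else 0)"

end

theory Submission
  imports Defs
begin

text \<open>
  The characters \<open>j \<mapsto> cis (2\<pi>rj/n)\<close> form an eigenbasis of the oriented cycle, with eigenvalues
  \<open>2 sin (2\<pi>r/n)\<close>. For odd \<open>n\<close> these are pairwise distinct, since \<open>sin a = sin b\<close> with
  \<open>a \<noteq> b\<close> modulo \<open>2\<pi>\<close> would force \<open>2(r + s)\<close> to be an odd multiple of \<open>n\<close>. Hence each entry of the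
  transition matrix is a trigonometric polynomial with \<open>n\<close> distinct frequencies and coefficients
  of modulus \<open>1/n\<close>, and averaging its squared modulus leaves only the diagonal terms,
  \<open>n \<cdot> 1/n\<^sup>2 = 1/n\<close>.
\<close>

section \<open>Time averages of trigonometric polynomials\<close>

lemma average_cis:
  fixes a :: real
  shows "((\<lambda>T. 1 / of_real T * integral {0..T} (\<lambda>t. cis (a * t))) \<longlongrightarrow> (if a = 0 then 1 else 0)) at_top"
proof (cases "a = 0")
  case True
  have "1 / complex_of_real T * integral {0..T} (\<lambda>t. cis (a * t)) = 1" if "T > 0" for T
    using that True by (simp add: scaleR_conv_of_real)
  then have "eventually (\<lambda>T. 1 / complex_of_real T * integral {0..T} (\<lambda>t. cis (a * t)) = 1) at_top"
    by (intro eventually_mono[OF eventually_gt_at_top[of 0]])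
  then show ?thesis
    using True by (simp add: tendsto_eventually)
next
  case False
  have int: "integral {0..T} (\<lambda>t. cis (a * t)) = (cis (a * T) - 1) / (\<i> * a)" if "T > 0" for T
  proof -
    have "((\<lambda>t. cis (a * t)) has_integral cis (a * T) / (\<i> * a) - cis (a * 0) / (\<i> * a)) {0..T}"
    proof (rule fundamental_theorem_of_calculus)
      fix x
      \<comment> \<open>The antiderivative is differentiated in a complex variable and then
        restricted to the real line.\<close>
      have "((\<lambda>z. exp (\<i> * of_real a * z) / (\<i> * of_real a)) has_field_derivative
              exp (\<i> * of_real a * of_real x)) (at (of_real x))"
        using False by (auto intro!: derivative_eq_intros)
      from has_vector_derivative_real_field[OF this]
      show "((\<lambda>t. cis (a * t) / (\<i> * a)) has_vector_derivative cis (a * x)) (at x within {0..T})"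
        by (simp add: cis_conv_exp mult.assoc)
    qed (use that in simp)
    then show ?thesis
      by (simp add: integral_unique diff_divide_distrib)
  qed
  have "((\<lambda>T. 1 / complex_of_real T * integral {0..T} (\<lambda>t. cis (a * t))) \<longlongrightarrow> 0) at_top"
  \<comment> \<open>For nonzero frequency the integral is bounded by
    \<open>2 / \<bar>a\<bar>\<close> uniformly in \<open>T\<close>, so division by \<open>T\<close>
    sends it to 0.\<close>
  proof (rule Lim_null_comparison)
    show "eventually (\<lambda>T. norm (1 / complex_of_real T * integral {0..T} (\<lambda>t. cis (a * t)))
            \<le> (2 / \<bar>a\<bar>) / T) at_top"
      using eventually_gt_at_top[of 0]
    proof eventually_elim
      case (elim T)
      have "norm (cis (a * T) - 1) \<le> 2"
        using norm_triangle_ineq4[of "cis (a * T)" 1] by simp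
      then show ?case
        unfolding int[OF elim] using elim False
        by (simp add: norm_mult norm_divide divide_simps mult.commute)
    qed
    show "((\<lambda>T. (2 / \<bar>a\<bar>) / T) \<longlongrightarrow> 0) at_top"
      by (intro tendsto_divide_0[OF tendsto_const]
          filterlim_at_top_imp_at_infinity filterlim_ident)
  qed
  then show ?thesis
    using False by simp
qed

text \<open>Expanding the square gives a double sum with frequencies
  \<open>\<theta> s - \<theta> r\<close>. By \<open>average_cis\<close> only frequency 0 survives
  the averaging, and injectivity of \<open>\<theta>\<close> confines it to \<open>r = s\<close>.
  This is where distinctness of the eigenvalues enters.\<close>

lemma average_norm_square_trig_poly:
  fixes c :: "'a \<Rightarrow> complex" and \<theta> :: "'a \<Rightarrow> real"
  assumes "finite S" and inj: "inj_on \<theta> S"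
  defines "f \<equiv> \<lambda>t. \<Sum>r\<in>S. c r * cis (- \<theta> r * t)"
  shows "((\<lambda>T. 1 / of_real T * integral {0..T} (\<lambda>t. f t * cnj (f t)))
           \<longlongrightarrow> (\<Sum>r\<in>S. c r * cnj (c r))) at_top"
proof -
  define A where "A a T = 1 / complex_of_real T * integral {0..T} (\<lambda>t. cis (a * t))" for a T :: real
  have expand: "f t * cnj (f t) = (\<Sum>r\<in>S. \<Sum>s\<in>S. c r * cnj (c s) * cis ((\<theta> s - \<theta> r) * t))" for t
  proof -
    have "cis ((\<theta> s - \<theta> r) * t) = cis (- \<theta> r * t) * cis (\<theta> s * t)" for r s
      by (simp add: cis_mult algebra_simps)
    then show ?thesis
      by (simp add: f_def sum_product cis_cnj mult_ac)
  qed
  have cont: "(\<lambda>t. cis (a * t)) integrable_on {0..T}" for a T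
    by (intro integrable_continuous_interval continuous_intros)
  have "integral {0..T} (\<lambda>t. f t * cnj (f t)) =
      (\<Sum>r\<in>S. \<Sum>s\<in>S. c r * cnj (c s) * integral {0..T} (\<lambda>t. cis ((\<theta> s - \<theta> r) * t)))" for T
    unfolding expand
    by (intro integral_unique has_integral_sum has_integral_mult_right integrable_integral
        cont \<open>finite S\<close>)
  then have avg: "1 / complex_of_real T * integral {0..T} (\<lambda>t. f t * cnj (f t)) =
      (\<Sum>r\<in>S. \<Sum>s\<in>S. c r * cnj (c s) * A (\<theta> s - \<theta> r) T)" for T
    by (simp add: A_def sum_divide_distrib)
  have "((\<lambda>T. \<Sum>r\<in>S. \<Sum>s\<in>S. c r * cnj (c s) * A (\<theta> s - \<theta> r) T) \<longlongrightarrow>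
      (\<Sum>r\<in>S. \<Sum>s\<in>S. c r * cnj (c s) * (if \<theta> s - \<theta> r = 0 then 1 else 0))) at_top"
    unfolding A_def by (intro tendsto_intros average_cis)
  also have "(\<Sum>r\<in>S. \<Sum>s\<in>S. c r * cnj (c s) * (if \<theta> s - \<theta> r = 0 then 1 else 0)) =
      (\<Sum>r\<in>S. \<Sum>s\<in>S. if s = r then c r * cnj (c s) else 0)"
    using inj by (intro sum.cong refl) (auto dest: inj_onD)
  also have "\<dots> = (\<Sum>r\<in>S. c r * cnj (c r))"
    using \<open>finite S\<close> by simp
  finally show ?thesis
    unfolding avg .
qed

section \<open>Characters of the cyclic group\<close>

lemma cis_two_pi_frac_eq_1_iff:
  fixes d :: int
  assumes "n > 0"
  shows "cis (2 * pi * of_int d / real n) = 1 \<longleftrightarrow> int n dvd d"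
proof -
  have "cis (2 * pi * of_int d / real n) = 1 \<longleftrightarrow> (\<exists>m::int. of_int d = (of_int m * real n))"
    using assms by (auto simp: cis_conv_exp exp_eq_1 field_simps)
  also have "\<dots> \<longleftrightarrow> (\<exists>m. d = m * int n)"
    by (metis of_int_eq_iff of_int_mult of_int_of_nat_eq)
  finally show ?thesis
    by (auto simp: dvd_def mult.commute)
qed

text \<open>The argument is an integer rather than a vertex, so that differences
  \<open>j - k\<close> and shifts by 1 need no reduction modulo \<open>n\<close>;
  \<open>character_periodic\<close> supplies the reduction when it is wanted.\<close>

definition character :: "nat \<Rightarrow> nat \<Rightarrow> int \<Rightarrow> complex" where
  "character n r d = cis (2 * pi * real r * of_int d / real n)"

lemma character_add: "character n r (d + e) = character n r d * character n r e"
  by (simp add: character_def cis_mult add_divide_distrib distrib_left)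

lemma character_periodic:
  assumes "n > 0" and "int n dvd d - e"
  shows "character n r d = character n r e"
proof -
  have "character n r (d - e) = 1"
    using assms cis_two_pi_frac_eq_1_iff[of n "int r * (d - e)"]
    by (simp add: character_def mult.assoc)
  then show ?thesis
    using character_add[of n r "d - e" e] by simp
qed

text \<open>Orthogonality of characters: a geometric sum over \<open>r\<close> whose ratio
  \<open>z\<close> is an \<open>n\<close>-th root of unity, so it vanishes unless
  \<open>z = 1\<close>.\<close>

lemma sum_character:
  assumes "n > 0"
  shows "(\<Sum>r<n. character n r d) = (if int n dvd d then of_nat n else 0)"
proof -
  define z where "z = cis (2 * pi * of_int d / real n)"
  have pow: "character n r d = z ^ r" for r
    by (simp add: z_def character_def Complex.DeMoivre mult_ac)
  have z: "z = 1 \<longleftrightarrow> int n dvd d"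
    using assms by (simp add: z_def cis_two_pi_frac_eq_1_iff)
  have "z ^ n = 1"
    using character_periodic[of n "d * int n" 0 1] assms
    by (simp add: z_def character_def Complex.DeMoivre mult_ac)
  then show ?thesis
    using z by (auto simp: pow sum_gp_strict)
qed

section \<open>Eigenvalues of the oriented cycle\<close>

definition eigenvalue_cycle :: "nat \<Rightarrow> nat \<Rightarrow> real" where
  "eigenvalue_cycle n r = 2 * sin (2 * pi * real r / real n)"

text \<open>This is the eigenvector equation read along a row of the matrix. With
  \<open>w = cis a\<close> it reduces to
  \<open>- \<i> * w + \<i> * cnj w = 2 * sin a\<close>.\<close>

lemma character_step:
  "- \<i> * character n r (d + 1) + \<i> * character n r (d - 1) =
     of_real (eigenvalue_cycle n r) * character n r d"
proof -
  have "character n r (d - 1) = character n r d * character n r (- 1)"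
    using character_add[of n r d "- 1"] by simp
  moreover have "- \<i> * character n r 1 + \<i> * character n r (- 1) = of_real (eigenvalue_cycle n r)"
    by (simp add: character_def eigenvalue_cycle_def complex_eq_iff)
  ultimately show ?thesis
    by (simp add: character_add flip: \<open>- \<i> * _ + _ = _\<close>) (simp add: algebra_simps)
qed

lemma inj_on_eigenvalue_cycle:
  assumes "odd n"
  shows "inj_on (eigenvalue_cycle n) {..<n}"
proof (rule inj_onI)
  fix r s
  assume r: "r \<in> {..<n}" and s: "s \<in> {..<n}" and eq: "eigenvalue_cycle n r = eigenvalue_cycle n s"
  have n: "n > 0"
    using r by auto
  from eq obtain x :: real where "x \<in> \<int>" and
    "2 * pi * real r / real n = 2 * pi * real s / real n + 2 * x * pi \<or>
     2 * pi * real r / real n = - (2 * pi * real s / real n) + (2 * x + 1) * pi"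
    unfolding eigenvalue_cycle_def sin_eq[of "2 * pi * real r / real n"] mult_cancel_left by auto
  then obtain m :: int where
    "2 * pi * real r / real n = 2 * pi * real s / real n + 2 * m * pi \<or>
     2 * pi * real r / real n = - (2 * pi * real s / real n) + (2 * m + 1) * pi"
    by (auto elim!: Ints_cases)
  then show "r = s"
  proof
    assume "2 * pi * real r / real n = 2 * pi * real s / real n + 2 * m * pi"
    then have "pi * (real r - real s) = pi * (m * real n)"
      using n by (simp add: field_simps)
    then have "real_of_int (int r - int s) = real_of_int (m * int n)"
      by simp
    then have "int n dvd int r - int s"
      by (simp only: of_int_eq_iff) simp
    then have "int r mod int n = int s mod int n"
      by (simp add: mod_eq_dvd_iff)
    then show "r = s"
      using r s by simp
  next
    assume "2 * pi * real r / real n = - (2 * pi * real s / real n) + (2 * m + 1) * pi"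
    then have "pi * (2 * (real r + real s)) = pi * ((2 * m + 1) * real n)"
      using n by (simp add: field_simps)
    then have "real_of_int (2 * (int r + int s)) = real_of_int ((2 * m + 1) * int n)"
      by simp
    then have "2 * (int r + int s) = (2 * m + 1) * int n"
      by (simp only: of_int_eq_iff)
    \<comment> \<open>A product of two odd numbers would be even, so the reflected solution of the
      sine equation cannot occur.\<close>
    then have "even ((2 * m + 1) * int n)"
      by (metis dvd_triv_left)
    then show "r = s"
      using assms by simp
  qed
qed

section \<open>Powers and exponential of the adjacency matrix\<close>

lemma dim_oriented_cycle [simp]:
  "dim_row (oriented_cycle n) = n" "dim_col (oriented_cycle n) = n"
  unfolding oriented_cycle_def by (rule dim_row_mat dim_col_mat)+

text \<open>Read by columns, the matrix is a sum of two indicator terms, which collapse the sum over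
  \<open>l\<close> in a matrix product. The sum agrees with the nested conditional because the two
  neighbours of \<open>k\<close> differ for \<open>n \<ge> 3\<close>. Writing
  \<open>k + n - 1\<close> avoids truncated subtraction at \<open>k = 0\<close>.\<close>

lemma oriented_cycle_entry:
  assumes "n \<ge> 3" and "l < n" and "k < n"
  shows "oriented_cycle n $$ (l, k) =
     (if l = (k + n - 1) mod n then - \<i> else 0) + (if l = (k + 1) mod n then \<i> else 0)"
proof -
  have pred: "(k + n - 1) mod n = (if k = 0 then n - 1 else k - 1)"
    using assms by (cases k) simp_all
  have succ: "(i + 1) mod n = (if i = n - 1 then 0 else i + 1)" if "i < n" for i
    using that by (cases "i = n - 1") simp_all
  have entry: "oriented_cycle n $$ (l, k) =
      (if k = (l + 1) mod n then - \<i> else if l = (k + 1) mod n then \<i> else 0)"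
    using assms(2,3) unfolding oriented_cycle_def by (subst index_mat(1)) (simp_all only: prod.case)
  show ?thesis
  proof (cases "k = (l + 1) mod n")
    case True
    then have "l = (k + n - 1) mod n" "l \<noteq> (k + 1) mod n"
      using assms unfolding pred succ[OF \<open>l < n\<close>] succ[OF \<open>k < n\<close>] by (auto split: if_splits)
    then show ?thesis
      unfolding entry if_P[OF True] if_P[OF \<open>l = _\<close>] if_not_P[OF \<open>l \<noteq> _\<close>]
      by (simp only: add_0_right)
  next
    case False
    then have "l \<noteq> (k + n - 1) mod n"
      using assms unfolding pred succ[OF \<open>l < n\<close>] by (auto split: if_splits)
    with False show ?thesis
      unfolding entry by (simp only: if_False add_0_left)
  qed
qed

text \<open>An entrywise spectral decomposition, obtained by induction instead of diagonalisation:
  \<open>sum_character\<close> gives the identity matrix for \<open>m = 0\<close>, and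
  \<open>character_step\<close> absorbs each further factor. The scalar \<open>c\<close> will become
  \<open>- \<i> * t\<close>.\<close>

lemma oriented_cycle_power_entry:
  fixes c :: complex
  assumes n: "n \<ge> 3" and "j < n" and "k < n"
  shows "((c \<cdot>\<^sub>m oriented_cycle n) ^\<^sub>m m) $$ (j, k) =
     (\<Sum>r<n. (c * eigenvalue_cycle n r) ^ m * character n r (int j - int k)) / of_nat n"
  using \<open>k < n\<close>
proof (induction m arbitrary: k)
  case 0
  have "int n dvd int j - int k \<longleftrightarrow> j = k"
    using 0 \<open>j < n\<close> unfolding mod_eq_dvd_iff[symmetric] by simp
  then show ?case
    using 0 \<open>j < n\<close> by (simp add: sum_character)
next
  case (Suc m)
  define B where "B = c \<cdot>\<^sub>m oriented_cycle n"
  define e where "e r d = (c * eigenvalue_cycle n r) ^ m * character n r d" for r d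
  have B: "B \<in> carrier_mat n n"
    by (intro carrier_matI) (simp_all add: B_def)
  then have Bm: "B ^\<^sub>m m \<in> carrier_mat n n"
    by simp
  define p q where "p = (k + n - 1) mod n" and "q = (k + 1) mod n"
  have pq: "p < n" "q < n"
    using n by (auto simp: p_def q_def)
  \<comment> \<open>Modulo \<open>n\<close>, \<open>p\<close> is \<open>k - 1\<close> and below
    \<open>q\<close> is \<open>k + 1\<close>; periodicity thus lets the characters ignore the
    wrap-around at the ends of the index range.\<close>
  have "int n dvd (int j - int p) - (int j - int k + 1)"
  proof -
    have "int p = (int k + int n - 1) mod int n"
      using n by (simp add: p_def of_nat_mod of_nat_diff)
    then have "int n dvd (int k + int n - 1) - int p"
      by (simp only: dvd_minus_mod)
    then have "int n dvd (int k + int n - 1) - int p - int n"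
      by (rule dvd_diff) simp
    then show ?thesis
      by (simp add: algebra_simps)
  qed
  then have p: "e r (int j - int p) = e r (int j - int k + 1)" for r
    unfolding e_def using n by (subst character_periodic) auto
  have "int n dvd (int j - int q) - (int j - int k - 1)"
  proof -
    have "int q = (int k + 1) mod int n"
      by (simp add: q_def of_nat_mod add.commute)
    then have "int n dvd (int k + 1) - int q"
      by (simp only: dvd_minus_mod)
    then show ?thesis
      by (simp add: algebra_simps)
  qed
  then have q: "e r (int j - int q) = e r (int j - int k - 1)" for r
    unfolding e_def using n by (subst character_periodic) auto
  have "(B ^\<^sub>m Suc m) $$ (j, k) = (\<Sum>l<n. (B ^\<^sub>m m) $$ (j, l) * B $$ (l, k))"
    using B Bm \<open>j < n\<close> Suc.prems by (simp add: scalar_prod_def lessThan_atLeast0)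
  also have "\<dots> = (\<Sum>l<n. (if l = p then (B ^\<^sub>m m) $$ (j, l) * (c * - \<i>) else 0) +
                        (if l = q then (B ^\<^sub>m m) $$ (j, l) * (c * \<i>) else 0))"
  proof (rule sum.cong)
    fix l
    assume "l \<in> {..<n}"
    then have "B $$ (l, k) = c * ((if l = p then - \<i> else 0) + (if l = q then \<i> else 0))"
      unfolding p_def q_def using oriented_cycle_entry[OF n _ Suc.prems] Suc.prems
      by (simp add: B_def)
    then show "(B ^\<^sub>m m) $$ (j, l) * B $$ (l, k) =
        (if l = p then (B ^\<^sub>m m) $$ (j, l) * (c * - \<i>) else 0) +
        (if l = q then (B ^\<^sub>m m) $$ (j, l) * (c * \<i>) else 0)"
      by (simp add: distrib_left)
  qed simp
  also have "\<dots> = (B ^\<^sub>m m) $$ (j, p) * (c * - \<i>) + (B ^\<^sub>m m) $$ (j, q) * (c * \<i>)"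
    using pq by (simp add: sum.distrib)
  also have "\<dots> = (\<Sum>r<n. c * (- \<i> * e r (int j - int k + 1) + \<i> * e r (int j - int k - 1))) / of_nat n"
    unfolding B_def Suc.IH[OF pq(1)] Suc.IH[OF pq(2)] e_def[symmetric] p q
    unfolding times_divide_eq_left add_divide_distrib[symmetric] sum_distrib_right
      sum.distrib[symmetric]
    by (simp add: algebra_simps)
  also have "(\<lambda>r. c * (- \<i> * e r (int j - int k + 1) + \<i> * e r (int j - int k - 1))) =
      (\<lambda>r. (c * eigenvalue_cycle n r) ^ Suc m * character n r (int j - int k))"
  proof
    fix r
    have "c * (- \<i> * e r (int j - int k + 1) + \<i> * e r (int j - int k - 1)) =
       c * (c * eigenvalue_cycle n r) ^ m *
       (- \<i> * character n r (int j - int k + 1) + \<i> * character n r (int j - int k - 1))"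
      by (simp add: e_def algebra_simps)
    then show "c * (- \<i> * e r (int j - int k + 1) + \<i> * e r (int j - int k - 1)) =
       (c * eigenvalue_cycle n r) ^ Suc m * character n r (int j - int k)"
      unfolding character_step by (simp add: mult_ac)
  qed
  finally show ?case
    unfolding B_def .
qed

text \<open>By the power formula the entrywise series is a finite combination of scalar exponential
  series, so series and sum over \<open>r\<close> may be interchanged.\<close>

lemma transition_matrix_oriented_cycle_entry:
  assumes "n \<ge> 3" and "j < n" and "k < n"
  shows "transition_matrix (oriented_cycle n) t $$ (j, k) =
     (\<Sum>r<n. character n r (int j - int k) / of_nat n * cis (- eigenvalue_cycle n r * t))"
proof -
  define x where "x r = - \<i> * of_real t * of_real (eigenvalue_cycle n r)" for r
  have "(\<lambda>m. \<Sum>r<n. character n r (int j - int k) / of_nat n * (x r ^ m /\<^sub>R fact m)) sums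
     (\<Sum>r<n. character n r (int j - int k) / of_nat n * exp (x r))"
    by (intro sums_sum sums_mult exp_converges)
  also have "(\<lambda>m. \<Sum>r<n. character n r (int j - int k) / of_nat n * (x r ^ m /\<^sub>R fact m)) =
     (\<lambda>m. (((- \<i> * of_real t) \<cdot>\<^sub>m oriented_cycle n) ^\<^sub>m m) $$ (j, k) / fact m)"
    unfolding oriented_cycle_power_entry[OF assms] x_def
    by (simp add: sum_divide_distrib scaleR_conv_of_real field_simps)
  finally have "(\<Sum>m. (((- \<i> * of_real t) \<cdot>\<^sub>m oriented_cycle n) ^\<^sub>m m) $$ (j, k) / fact m) =
     (\<Sum>r<n. character n r (int j - int k) / of_nat n * exp (x r))"
    by (rule sums_unique[symmetric])
  then show ?thesis
    using assms by (simp add: transition_matrix_def mat_exp_def x_def cis_conv_exp mult_ac)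
qed

section \<open>Average uniform mixing\<close>

lemma time_average_oriented_cycle:
  assumes "odd n" and "n \<ge> 3" and "j < n" and "k < n"
  shows "(time_average (oriented_cycle n) j k \<longlongrightarrow> 1 / of_nat n) at_top"
proof -
  let ?c = "\<lambda>r. character n r (int j - int k) / of_nat n"
  let ?f = "\<lambda>t. \<Sum>r<n. ?c r * cis (- eigenvalue_cycle n r * t)"
  have "mixing_matrix (oriented_cycle n) t $$ (j, k) = ?f t * cnj (?f t)" for t
  proof -
    have dim: "dim_row (transition_matrix (oriented_cycle n) t) = n"
      "dim_col (transition_matrix (oriented_cycle n) t) = n"
      by (simp_all add: transition_matrix_def mat_exp_def)
    show ?thesis
      using assms
      by (simp add: mixing_matrix_def hadamard_prod_def dim transition_matrix_oriented_cycle_entry)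
  qed
  then have "time_average (oriented_cycle n) j k =
      (\<lambda>T. 1 / of_real T * integral {0..T} (\<lambda>t. ?f t * cnj (?f t)))"
    by (simp add: time_average_def fun_eq_iff)
  moreover have "(\<Sum>r<n. ?c r * cnj (?c r)) = 1 / of_nat n"
    using assms(2) by (simp add: character_def cis_cnj cis_mult power2_eq_square)
  ultimately show ?thesis
    using average_norm_square_trig_poly[OF finite_lessThan inj_on_eigenvalue_cycle[OF \<open>odd n\<close>], of ?c]
    by simp
qed

theorem corollary5:
  fixes n :: nat
  assumes "odd n" and "n \<ge> 3"
  shows "average_uniform_mixing (oriented_cycle n)"
proof -
  note lim = time_average_oriented_cycle[OF assms]
  \<comment> \<open>Uniqueness of limits along \<open>at_top\<close> fixes the value of
    \<open>Lim\<close>; \<open>lim\<close> itself later settles the existence clause.\<close>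
  have "Lim at_top (time_average (oriented_cycle n) j k) = 1 / of_nat n" if "j < n" "k < n" for j k
    using lim[OF that] by (intro tendsto_Lim) simp_all
  then have "average_mixing_matrix (oriented_cycle n) = (1 / of_nat n) \<cdot>\<^sub>m all_ones_mat n"
    by (intro eq_matI) (auto simp: average_mixing_matrix_def all_ones_mat_def)
  then show ?thesis
    unfolding average_uniform_mixing_def using lim by auto
qed

end
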